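(* Let $0<\alpha<1$ and $U=\prod_{i=1}^d[0,b_i]\subset\mathbb{R}^d$ with all $b_i>0$ ($d\ge1$). The fractional exterior differential $d^\alpha$ is not a graded derivation of the ordinary wedge product on $\Omega_\alpha^\bullet(U;\mathscr{P}_\alpha)$. In particular, there exist homogeneous forms $\omega,\eta\in\Omega_\alpha^\bullet(U;\mathscr{P}_\alpha)$ such that $$d^\alpha(\omega\wedge\eta)\neq d^\alpha\omega\wedge\eta+(-1)^{\deg\omega}\,\omega\wedge d^\alpha\eta .$$
   Context: Let $X_i^\alpha(x)=x_i^\alpha/\Gamma(1+\alpha)$ and $\mathscr{P}_\alpha(U)=\mathbb{R}[X_1^\alpha,\dots,X_d^\alpha]$, the algebra of functions on $U$ generated by the $X_i^\alpha$. These functions are algebraically independent, so each element is uniquely a finite linear combination of monomials. The polynomial Caputo operator $\mathsf{D}_i^\alpha:\mathscr{P}_\alpha(U)\to\mathscr{P}_\alpha(U)$ is the $\mathbb{R}$-linear map defined on monomials $M=\prod_{k=1}^d(X_k^\alpha)^{m_k}$, $m_k\in\mathbb{Z}_{\ge0}$, by $$\mathsf{D}_i^\alpha M=\frac{\Gamma(m_i\alpha+1)}{\Gamma((m_i-1)\alpha+1)\Gamma(1+\alpha)}(X_i^\alpha)^{m_i-1}\prod_{j\ne i}(X_j^\alpha)^{m_j}\ \text{ if } m_i\ge1,\qquad \mathsf{D}_i^\alpha M=0\ \text{ if } m_i=0.$$ Let $d^\alpha X_1,\dots,d^\alpha X_d$ be formal degree-one generators with $d^\alpha X_i\wedge d^\alpha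 X_j=-d^\alpha X_j\wedge d^\alpha X_i$ and $d^\alpha X_i\wedge d^\alpha X_i=0$. For $I=(i_1<\dots<i_p)$ put $d^\alpha X_I=d^\alpha X_{i_1}\wedge\cdots\wedge d^\alpha X_{i_p}$, $\Omega_\alpha^p(U;\mathscr{P}_\alpha)=\bigoplus_{|I|=p}\mathscr{P}_\alpha(U)\,d^\alpha X_I$ and $\Omega_\alpha^\bullet(U;\mathscr{P}_\alpha)=\bigoplus_{p=0}^d\Omega_\alpha^p(U;\mathscr{P}_\alpha)$, i.e. the exterior algebra over $\mathscr{P}_\alpha(U)$ on these generators. The ordinary wedge product is the exterior product generated by the symbols $d^\alpha X_i$ together with ordinary multiplication of coefficients. The fractional exterior differential is $$d^\alpha\Bigl(\sum_{|I|=p}a_I\,d^\alpha X_I\Bigr)=\sum_{|I|=p}\sum_{i=1}^d(\mathsf{D}_i^\alpha a_I)\,d^\alpha X_i\wedge d^\alpha X_I .$$ *)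

theory Defs
  imports "HOL-Analysis.Analysis"
begin

text \<open>
  The dimension \<open>d\<close> is the cardinality of the index type \<open>'n\<close>; its linear order is the order of the
  coordinates, used for increasing multi-indices.  A real function on a subset \<open>U\<close> of \<open>real ^ 'n\<close> is
  represented by its extension by \<open>0\<close>, so that two functions on \<open>U\<close> coincide iff their
  representatives are equal.
\<close>

definition frac_X :: "real \<Rightarrow> (real ^ 'n) set \<Rightarrow> 'n \<Rightarrow> (real ^ 'n \<Rightarrow> real)" where
  "frac_X \<alpha> U i = (\<lambda>x. if x \<in> U then (x $ i) powr \<alpha> / Gamma (1 + \<alpha>) else 0)"

inductive_set frac_poly :: "real \<Rightarrow> (real ^ 'n) set \<Rightarrow> (real ^ 'n \<Rightarrow> real) set"
  for \<alpha> :: real and U :: "(real ^ 'n) set"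
where
  const: "(\<lambda>x. if x \<in> U then c else 0) \<in> frac_poly \<alpha> U"
| gen: "frac_X \<alpha> U i \<in> frac_poly \<alpha> U"
| add: "f \<in> frac_poly \<alpha> U \<Longrightarrow> g \<in> frac_poly \<alpha> U \<Longrightarrow> (\<lambda>x. f x + g x) \<in> frac_poly \<alpha> U"
| mult: "f \<in> frac_poly \<alpha> U \<Longrightarrow> g \<in> frac_poly \<alpha> U \<Longrightarrow> (\<lambda>x. f x * g x) \<in> frac_poly \<alpha> U"

text \<open>The guard matters only for the empty monomial, which is the unit (the function \<open>1\<close> on \<open>U\<close>).\<close>

definition frac_monom :: "real \<Rightarrow> (real ^ 'n) set \<Rightarrow> ('n \<Rightarrow> nat) \<Rightarrow> (real ^ 'n \<Rightarrow> real)" where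
  "frac_monom \<alpha> U m = (\<lambda>x. if x \<in> U then (\<Prod>k\<in>UNIV. frac_X \<alpha> U k x ^ m k) else 0)"

definition is_frac_expansion ::
    "real \<Rightarrow> (real ^ 'n) set \<Rightarrow> (real ^ 'n \<Rightarrow> real) \<Rightarrow> (('n \<Rightarrow> nat) \<Rightarrow> real) \<Rightarrow> bool" where
  "is_frac_expansion \<alpha> U f c \<longleftrightarrow>
     finite {m. c m \<noteq> 0} \<and> f = (\<lambda>x. \<Sum>m | c m \<noteq> 0. c m * frac_monom \<alpha> U m x)"

text \<open>
  For \<open>0 < \<alpha>\<close>, \<open>U = cbox 0 b\<close> with all \<open>b $ i > 0\<close> and \<open>f \<in> frac_poly \<alpha> U\<close>, the expansion exists
  and is unique, so that \<open>caputo\<close> is the linear extension of \<open>caputo_monom\<close>; see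
  \<open>frac_expansion_ex1\<close>, \<open>caputo_frac_monom\<close> and \<open>caputo_linear\<close>.
\<close>

definition frac_coeffs ::
    "real \<Rightarrow> (real ^ 'n) set \<Rightarrow> (real ^ 'n \<Rightarrow> real) \<Rightarrow> (('n \<Rightarrow> nat) \<Rightarrow> real)" where
  "frac_coeffs \<alpha> U f = (THE c. is_frac_expansion \<alpha> U f c)"

definition caputo_monom ::
    "real \<Rightarrow> (real ^ 'n) set \<Rightarrow> 'n \<Rightarrow> ('n \<Rightarrow> nat) \<Rightarrow> (real ^ 'n \<Rightarrow> real)" where
  "caputo_monom \<alpha> U i m =
     (if m i = 0 then (\<lambda>x. 0)
      else (\<lambda>x. Gamma (real (m i) * \<alpha> + 1)
                  / (Gamma (real (m i - 1) * \<alpha> + 1) * Gamma (1 + \<alpha>))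
                  * frac_monom \<alpha> U (m(i := m i - 1)) x))"

definition caputo ::
    "real \<Rightarrow> (real ^ 'n) set \<Rightarrow> 'n \<Rightarrow> (real ^ 'n \<Rightarrow> real) \<Rightarrow> (real ^ 'n \<Rightarrow> real)" where
  "caputo \<alpha> U i f =
     (\<lambda>x. \<Sum>m | frac_coeffs \<alpha> U f m \<noteq> 0. frac_coeffs \<alpha> U f m * caputo_monom \<alpha> U i m x)"

text \<open>
  A multi-index \<open>i\<^sub>1 < \<dots> < i\<^sub>p\<close> is identified with the set of its entries, and a form
  \<open>\<Sum>\<^sub>I a\<^sub>I dX\<^sub>I\<close> with the family of its coefficients \<open>a\<^sub>I\<close>.
\<close>

type_synonym 'n frac_form = "'n set \<Rightarrow> (real ^ 'n \<Rightarrow> real)"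

definition frac_forms :: "real \<Rightarrow> (real ^ 'n) set \<Rightarrow> 'n frac_form set" where
  "frac_forms \<alpha> U = {\<omega>. \<forall>I. \<omega> I \<in> frac_poly \<alpha> U}"

definition frac_forms_deg :: "real \<Rightarrow> (real ^ 'n) set \<Rightarrow> nat \<Rightarrow> 'n frac_form set" where
  "frac_forms_deg \<alpha> U p =
     {\<omega> \<in> frac_forms \<alpha> U. \<forall>I. card I \<noteq> p \<longrightarrow> \<omega> I = (\<lambda>x. 0)}"

text \<open>
  \<open>wedge_coeff I J K\<close> is the coefficient of \<open>dX\<^sub>K\<close> in \<open>dX\<^sub>I \<and> dX\<^sub>J\<close>: the product vanishes on a repeated
  generator, and otherwise sorting the concatenation of \<open>I\<close> and \<open>J\<close> costs one sign per inversion.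
  The lemmas on \<open>wedge_coeff\<close> below confirm that this is the exterior algebra on the \<open>dX\<^sub>i\<close>.
\<close>

definition wedge_coeff :: "'n::linorder set \<Rightarrow> 'n set \<Rightarrow> 'n set \<Rightarrow> real" where
  "wedge_coeff I J K =
     (if I \<inter> J = {} \<and> K = I \<union> J then (- 1) ^ card {(i, j). i \<in> I \<and> j \<in> J \<and> j < i} else 0)"

definition wedge ::
    "'n::{finite,linorder} frac_form \<Rightarrow> 'n frac_form \<Rightarrow> 'n frac_form" where
  "wedge \<omega> \<eta> = (\<lambda>K x. \<Sum>I\<in>UNIV. \<Sum>J\<in>UNIV. wedge_coeff I J K * (\<omega> I x * \<eta> J x))"

definition frac_d ::
    "real \<Rightarrow> (real ^ 'n::{finite,linorder}) set \<Rightarrow> 'n frac_form \<Rightarrow> 'n frac_form" where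
  "frac_d \<alpha> U \<omega> = (\<lambda>K x. \<Sum>I\<in>UNIV. \<Sum>i\<in>UNIV. wedge_coeff {i} I K * caputo \<alpha> U i (\<omega> I) x)"

definition graded_leibniz ::
    "real \<Rightarrow> (real ^ 'n::{finite,linorder}) set \<Rightarrow> ('n frac_form \<Rightarrow> 'n frac_form) \<Rightarrow> bool" where
  "graded_leibniz \<alpha> U \<delta> \<longleftrightarrow>
     (\<forall>p q. \<forall>\<omega>\<in>frac_forms_deg \<alpha> U p. \<forall>\<eta>\<in>frac_forms_deg \<alpha> U q.
        \<delta> (wedge \<omega> \<eta>) = (\<lambda>I x. wedge (\<delta> \<omega>) \<eta> I x + (- 1) ^ p * wedge \<omega> (\<delta> \<eta>) I x))"

definition graded_derivation ::
    "real \<Rightarrow> (real ^ 'n::{finite,linorder}) set \<Rightarrow> ('n frac_form \<Rightarrow> 'n frac_form) \<Rightarrow> bool" where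
  "graded_derivation \<alpha> U \<delta> \<longleftrightarrow>
     (\<forall>\<omega>\<in>frac_forms \<alpha> U. \<forall>\<eta>\<in>frac_forms \<alpha> U. \<forall>r s.
        \<delta> (\<lambda>I x. r * \<omega> I x + s * \<eta> I x) = (\<lambda>I x. r * \<delta> \<omega> I x + s * \<delta> \<eta> I x)) \<and>
     (\<forall>p. \<delta> ` frac_forms_deg \<alpha> U p \<subseteq> frac_forms_deg \<alpha> U (Suc p)) \<and>
     graded_leibniz \<alpha> U \<delta>"

lemma frac_indep_aux:
  fixes c :: "('n \<Rightarrow> nat) \<Rightarrow> real" and A :: "'n \<Rightarrow> real set"
  assumes "finite S" "finite M" "\<And>k. infinite (A k)"
    and "\<And>m m'. m \<in> M \<Longrightarrow> m' \<in> M \<Longrightarrow> (\<forall>k\<in>S. m k = m' k) \<Longrightarrow> m = m'"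
    and "\<And>t. (\<forall>k. t k \<in> A k) \<Longrightarrow> (\<Sum>m\<in>M. c m * (\<Prod>k\<in>S. t k ^ m k)) = 0"
    and "m \<in> M"
  shows "c m = 0"
  using assms(1,2,4-)
proof (induction S arbitrary: M m rule: finite_induct)
  case empty
  then have "M = {m}" by auto
  moreover have "\<exists>t. \<forall>k. t k \<in> A k"
    by (intro choice allI) (metis assms(3) all_not_in_conv finite.emptyI)
  ultimately show ?case using empty.prems(3) by auto
next
  case (insert s S)
  define N where "N = Max ((\<lambda>m. m s) ` M)"
  have le: "m' s \<le> N" if "m' \<in> M" for m'
    using that insert.prems(1) by (auto simp: N_def)
  define M' where "M' = {m' \<in> M. m' s = m s}"
  show ?case
  proof (rule insert.IH[of M'])
    show "finite M'" "m \<in> M'" using insert.prems by (auto simp: M'_def)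
    show "m1 = m2" if "m1 \<in> M'" "m2 \<in> M'" "\<forall>k\<in>S. m1 k = m2 k" for m1 m2
      using insert.prems(2)[of m1 m2] that by (auto simp: M'_def)
    fix t assume t: "\<forall>k. t k \<in> A k"
    define a where "a j = (\<Sum>m'\<in>{m' \<in> M. m' s = j}. c m' * (\<Prod>k\<in>S. t k ^ m' k))" for j
    have "(\<Sum>j\<le>N. a j * z ^ j) = 0" if z: "z \<in> A s" for z
    proof -
      have "(\<Sum>j\<le>N. a j * z ^ j)
          = (\<Sum>j\<le>N. \<Sum>m'\<in>{m' \<in> M. m' s = j}. c m' * (\<Prod>k\<in>insert s S. (t(s := z)) k ^ m' k))"
        unfolding a_def sum_distrib_right
      proof (intro sum.cong refl)
        fix j m' assume m': "m' \<in> {m' \<in> M. m' s = j}"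
        have "(\<Prod>k\<in>S. (t(s := z)) k ^ m' k) = (\<Prod>k\<in>S. t k ^ m' k)"
          using insert.hyps by (intro prod.cong) auto
        then show "c m' * (\<Prod>k\<in>S. t k ^ m' k) * z ^ j
            = c m' * (\<Prod>k\<in>insert s S. (t(s := z)) k ^ m' k)"
          using m' insert.hyps by simp
      qed
      also have "\<dots> = (\<Sum>m'\<in>M. c m' * (\<Prod>k\<in>insert s S. (t(s := z)) k ^ m' k))"
        using insert.prems(1) le by (intro sum.group) auto
      also have "\<dots> = 0"
        using t z by (intro insert.prems(3)) auto
      finally show ?thesis .
    qed
    then have "A s \<subseteq> {z. (\<Sum>j\<le>N. a j * z ^ j) = 0}" by auto
    then have "infinite {z. (\<Sum>j\<le>N. a j * z ^ j) = 0}"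
      using assms(3) finite_subset by blast
    then have "a (m s) = 0"
      using polyfun_finite_roots[of a N] le[OF insert.prems(4)] by auto
    then show "(\<Sum>m\<in>M'. c m * (\<Prod>k\<in>S. t k ^ m k)) = 0"
      by (simp add: a_def M'_def)
  qed
qed

lemma frac_expansion_unique:
  fixes b :: "real ^ 'n"
  assumes "0 < \<alpha>" "\<And>i. 0 < b $ i"
    and "is_frac_expansion \<alpha> (cbox 0 b) f c" "is_frac_expansion \<alpha> (cbox 0 b) f c'"
  shows "c = c'"
proof -
  let ?U = "cbox 0 b"
  define M where "M = {m. c m \<noteq> 0} \<union> {m. c' m \<noteq> 0}"
  have finM: "finite M" using assms(3,4) by (auto simp: M_def is_frac_expansion_def)
  have f1: "f x = (\<Sum>m\<in>M. c m * frac_monom \<alpha> ?U m x)" for x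
    using assms(3) finM unfolding is_frac_expansion_def
    by (auto intro!: sum.mono_neutral_left simp: M_def)
  have f2: "f x = (\<Sum>m\<in>M. c' m * frac_monom \<alpha> ?U m x)" for x
    using assms(4) finM unfolding is_frac_expansion_def
    by (auto intro!: sum.mono_neutral_left simp: M_def)
  define G where "G = Gamma (1 + \<alpha>)"
  have G: "G > 0" using assms(1) by (simp add: G_def)
  define A where "A k = (\<lambda>y. y powr \<alpha> / G) ` {0..b $ k}" for k
  have infA: "infinite (A k)" for k
  proof -
    have "inj_on (\<lambda>y. y powr \<alpha> / G) {0..b $ k}"
    proof (rule inj_onI)
      fix y z assume yz: "y \<in> {0..b $ k}" "z \<in> {0..b $ k}" "y powr \<alpha> / G = z powr \<alpha> / G"
      then have "y powr \<alpha> = z powr \<alpha>" using G by simp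
      then show "y = z" using yz assms(1)
        by (metis atLeastAtMost_iff linorder_less_linear order_less_irrefl powr_less_mono2)
    qed
    then show ?thesis
      using assms(2)[of k] by (simp add: A_def finite_image_iff infinite_Icc_iff)
  qed
  have zero: "(\<Sum>m\<in>M. (c m - c' m) * (\<Prod>k\<in>UNIV. t k ^ m k)) = 0" if t: "\<forall>k. t k \<in> A k" for t
  proof -
    have "\<forall>k. \<exists>y. y \<in> {0..b $ k} \<and> t k = y powr \<alpha> / G"
      using t unfolding A_def by blast
    then obtain y where y: "\<And>k. y k \<in> {0..b $ k}" "\<And>k. t k = y k powr \<alpha> / G" by metis
    define x :: "real ^ 'n" where "x = (\<chi> k. y k)"
    have "x \<in> ?U" using y(1) by (simp add: x_def mem_box_cart)
    then have "frac_monom \<alpha> ?U m x = (\<Prod>k\<in>UNIV. t k ^ m k)" for m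
      by (simp add: frac_monom_def frac_X_def x_def y(2) G_def)
    then show ?thesis
      using f1[of x] f2[of x] by (simp add: left_diff_distrib sum_subtractf)
  qed
  have "c m - c' m = 0" if "m \<in> M" for m
    by (rule frac_indep_aux[of "UNIV" M A "\<lambda>m. c m - c' m"]) (use finM infA zero that in auto)
  then have "c m = c' m" for m by (cases "m \<in> M") (auto simp: M_def)
  then show "c = c'" by blast
qed

lemma is_frac_expansionI:
  assumes "finite M" "\<And>m. m \<notin> M \<Longrightarrow> c m = 0" "\<And>x. f x = (\<Sum>m\<in>M. c m * frac_monom \<alpha> U m x)"
  shows "is_frac_expansion \<alpha> U f c"
proof -
  have sub: "{m. c m \<noteq> 0} \<subseteq> M" using assms(2) by auto
  then have "f x = (\<Sum>m | c m \<noteq> 0. c m * frac_monom \<alpha> U m x)" for x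
    unfolding assms(3) using assms(1) by (intro sum.mono_neutral_right) auto
  then show ?thesis
    using finite_subset[OF sub assms(1)] by (auto simp: is_frac_expansion_def)
qed

lemma is_frac_expansion_monom:
  "is_frac_expansion \<alpha> U (\<lambda>x. r * frac_monom \<alpha> U m x) (\<lambda>m'. if m' = m then r else 0)"
  by (rule is_frac_expansionI[of "{m}"]) auto

lemma is_frac_expansion_add:
  assumes "is_frac_expansion \<alpha> U f c" "is_frac_expansion \<alpha> U g c'"
  shows "is_frac_expansion \<alpha> U (\<lambda>x. f x + g x) (\<lambda>m. c m + c' m)"
proof (rule is_frac_expansionI[of "{m. c m \<noteq> 0} \<union> {m. c' m \<noteq> 0}"])
  let ?M = "{m. c m \<noteq> 0} \<union> {m. c' m \<noteq> 0}"
  show fin: "finite ?M" using assms by (auto simp: is_frac_expansion_def)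
  show "f x + g x = (\<Sum>m\<in>?M. (c m + c' m) * frac_monom \<alpha> U m x)" for x
  proof -
    have "f x = (\<Sum>m\<in>?M. c m * frac_monom \<alpha> U m x)"
      using assms(1) fin unfolding is_frac_expansion_def
      by (auto intro!: sum.mono_neutral_left)
    moreover have "g x = (\<Sum>m\<in>?M. c' m * frac_monom \<alpha> U m x)"
      using assms(2) fin unfolding is_frac_expansion_def
      by (auto intro!: sum.mono_neutral_left)
    ultimately show ?thesis by (simp add: distrib_right sum.distrib)
  qed
qed auto

lemma frac_monom_mult:
  "frac_monom \<alpha> U m x * frac_monom \<alpha> U m' x = frac_monom \<alpha> U (\<lambda>k. m k + m' k) x"
  by (simp add: frac_monom_def power_add prod.distrib)

lemma is_frac_expansion_sum:
  assumes "finite S" "\<And>s. s \<in> S \<Longrightarrow> \<exists>c. is_frac_expansion \<alpha> U (h s) c"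
  shows "\<exists>c. is_frac_expansion \<alpha> U (\<lambda>x. \<Sum>s\<in>S. h s x) c"
  using assms
proof (induction S rule: finite_induct)
  case empty
  have "is_frac_expansion \<alpha> U (\<lambda>x. 0) (\<lambda>m. 0)" by (rule is_frac_expansionI[of "{}"]) auto
  then show ?case by auto
next
  case (insert s S)
  then obtain c c' where "is_frac_expansion \<alpha> U (h s) c"
    "is_frac_expansion \<alpha> U (\<lambda>x. \<Sum>s\<in>S. h s x) c'" by blast
  from is_frac_expansion_add[OF this] insert.hyps show ?case by auto
qed

lemma frac_expansion_exists:
  assumes "f \<in> frac_poly \<alpha> U"
  shows "\<exists>c. is_frac_expansion \<alpha> U f c"
  using assms
proof induction
  case (const r)
  have "(\<lambda>x. if x \<in> U then r else 0) = (\<lambda>x. r * frac_monom \<alpha> U (\<lambda>_. 0) x)"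
    by (auto simp: frac_monom_def)
  then show ?case using is_frac_expansion_monom[of \<alpha> U r] by auto
next
  case (gen i)
  have "frac_X \<alpha> U i x = 1 * frac_monom \<alpha> U (\<lambda>k. if k = i then 1 else 0) x" for x
  proof -
    have "(\<Prod>k\<in>UNIV. frac_X \<alpha> U k x ^ (if k = i then 1 else 0))
        = (\<Prod>k\<in>UNIV. if k = i then frac_X \<alpha> U k x else 1)"
      by (intro prod.cong) auto
    also have "\<dots> = frac_X \<alpha> U i x" by simp
    finally show ?thesis by (simp add: frac_monom_def) (simp add: frac_X_def)
  qed
  then have "frac_X \<alpha> U i = (\<lambda>x. 1 * frac_monom \<alpha> U (\<lambda>k. if k = i then 1 else 0) x)" by blast
  then show ?case
    using is_frac_expansion_monom[of \<alpha> U 1 "\<lambda>k. if k = i then 1 else 0"] by (simp only:) blast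
next
  case (add f g)
  then show ?case using is_frac_expansion_add by blast
next
  case (mult f g)
  then obtain c c' where c: "is_frac_expansion \<alpha> U f c" "is_frac_expansion \<alpha> U g c'" by blast
  let ?S = "{m. c m \<noteq> 0} \<times> {m. c' m \<noteq> 0}"
  have "finite ?S" using c by (auto simp: is_frac_expansion_def)
  moreover have "(\<lambda>x. f x * g x)
      = (\<lambda>x. \<Sum>s\<in>?S. (c (fst s) * c' (snd s)) * frac_monom \<alpha> U (\<lambda>k. fst s k + snd s k) x)"
    (is "_ = ?rhs")
  proof
    fix x
    have "f x * g x = (\<Sum>m | c m \<noteq> 0. c m * frac_monom \<alpha> U m x)
        * (\<Sum>m | c' m \<noteq> 0. c' m * frac_monom \<alpha> U m x)"
      using c by (simp add: is_frac_expansion_def)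
    also have "\<dots> = ?rhs x"
      unfolding sum_product sum.cartesian_product
      by (intro sum.cong refl) (auto simp: frac_monom_mult[symmetric])
    finally show "f x * g x = ?rhs x" .
  qed
  moreover have "\<exists>c. is_frac_expansion \<alpha> U ?rhs c" if "finite ?S"
    by (rule is_frac_expansion_sum[OF that], rule exI, rule is_frac_expansion_monom)
  ultimately show ?case by (simp only:)
qed

lemma frac_expansion_ex1:
  fixes b :: "real ^ 'n"
  assumes "0 < \<alpha>" "\<And>i. 0 < b $ i" "f \<in> frac_poly \<alpha> (cbox 0 b)"
  shows "\<exists>!c. is_frac_expansion \<alpha> (cbox 0 b) f c"
  using frac_expansion_exists[OF assms(3)] frac_expansion_unique[OF assms(1,2)] by blast

lemma frac_coeffs_eq:
  fixes b :: "real ^ 'n"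
  assumes "0 < \<alpha>" "\<And>i. 0 < b $ i" "is_frac_expansion \<alpha> (cbox 0 b) f c"
  shows "frac_coeffs \<alpha> (cbox 0 b) f = c"
  unfolding frac_coeffs_def using frac_expansion_unique[OF assms(1,2)] assms(3) by blast

lemma caputo_expansion:
  fixes b :: "real ^ 'n"
  assumes "0 < \<alpha>" "\<And>i. 0 < b $ i" "is_frac_expansion \<alpha> (cbox 0 b) f c"
    and "finite M" "\<And>m. m \<notin> M \<Longrightarrow> c m = 0"
  shows "caputo \<alpha> (cbox 0 b) i f x = (\<Sum>m\<in>M. c m * caputo_monom \<alpha> (cbox 0 b) i m x)"
  unfolding caputo_def frac_coeffs_eq[OF assms(1-3)]
  using assms(4,5) by (intro sum.mono_neutral_left) auto

lemma caputo_frac_monom: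
  fixes b :: "real ^ 'n"
  assumes "0 < \<alpha>" "\<And>i. 0 < b $ i"
  shows "caputo \<alpha> (cbox 0 b) i (frac_monom \<alpha> (cbox 0 b) m) = caputo_monom \<alpha> (cbox 0 b) i m"
proof
  have "is_frac_expansion \<alpha> (cbox 0 b) (frac_monom \<alpha> (cbox 0 b) m) (\<lambda>m'. if m' = m then 1 else 0)"
    using is_frac_expansion_monom[of \<alpha> "cbox 0 b" 1 m] by simp
  from caputo_expansion[OF assms this, of "{m}"]
  show "caputo \<alpha> (cbox 0 b) i (frac_monom \<alpha> (cbox 0 b) m) x
      = caputo_monom \<alpha> (cbox 0 b) i m x" for x by simp
qed

lemma is_frac_expansion_scale:
  assumes "is_frac_expansion \<alpha> U f c"
  shows "is_frac_expansion \<alpha> U (\<lambda>x. r * f x) (\<lambda>m. r * c m)"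
  using assms
  by (intro is_frac_expansionI[of "{m. c m \<noteq> 0}"])
     (auto simp: is_frac_expansion_def sum_distrib_left mult.assoc)

lemma caputo_linear:
  fixes b :: "real ^ 'n"
  assumes "0 < \<alpha>" "\<And>i. 0 < b $ i"
    and "f \<in> frac_poly \<alpha> (cbox 0 b)" "g \<in> frac_poly \<alpha> (cbox 0 b)"
  shows "caputo \<alpha> (cbox 0 b) i (\<lambda>x. r * f x + s * g x)
       = (\<lambda>x. r * caputo \<alpha> (cbox 0 b) i f x + s * caputo \<alpha> (cbox 0 b) i g x)"
proof
  fix x
  obtain c c' where c: "is_frac_expansion \<alpha> (cbox 0 b) f c" "is_frac_expansion \<alpha> (cbox 0 b) g c'"
    using frac_expansion_exists assms(3,4) by blast
  let ?M = "{m. c m \<noteq> 0} \<union> {m. c' m \<noteq> 0}"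
  have M: "finite ?M" using c by (auto simp: is_frac_expansion_def)
  note exp = caputo_expansion[OF assms(1,2) _ M, of _ _ i x]
  have "caputo \<alpha> (cbox 0 b) i (\<lambda>x. r * f x + s * g x) x
      = (\<Sum>m\<in>?M. (r * c m + s * c' m) * caputo_monom \<alpha> (cbox 0 b) i m x)"
    by (rule exp[OF is_frac_expansion_add[OF is_frac_expansion_scale[OF c(1)]
            is_frac_expansion_scale[OF c(2)]]]) auto
  also have "\<dots> = r * caputo \<alpha> (cbox 0 b) i f x + s * caputo \<alpha> (cbox 0 b) i g x"
    using exp[OF c(1)] exp[OF c(2)] by (simp add: distrib_right sum.distrib sum_distrib_left mult.assoc)
  finally show "caputo \<alpha> (cbox 0 b) i (\<lambda>x. r * f x + s * g x) x
      = r * caputo \<alpha> (cbox 0 b) i f x + s * caputo \<alpha> (cbox 0 b) i g x" .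
qed

lemma wedge_coeff_gen_anticomm:
  fixes i j :: "'n::linorder"
  shows "wedge_coeff {i} {j} K = - wedge_coeff {j} {i} K" "wedge_coeff {i} {i} K = 0"
proof -
  have "{(i', j'). i' \<in> {i} \<and> j' \<in> {j} \<and> j' < i'} = (if j < i then {(i, j)} else {})" for i j :: 'n
    by auto
  then show "wedge_coeff {i} {j} K = - wedge_coeff {j} {i} K"
    by (auto simp: wedge_coeff_def insert_commute)
qed (simp add: wedge_coeff_def)

lemma wedge_coeff_Min:
  fixes I :: "'n::{finite,linorder} set"
  assumes "\<And>j. j \<in> I \<Longrightarrow> i < j"
  shows "wedge_coeff {i} I (insert i I) = 1"
proof -
  have "{(i', j). i' \<in> {i} \<and> j \<in> I \<and> j < i'} = {}" using assms by fastforce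
  moreover have "i \<notin> I" using assms by blast
  ultimately show ?thesis unfolding wedge_coeff_def by (simp only:) simp
qed

lemma wedge_coeff_assoc:
  fixes I J K L :: "'n::{finite,linorder} set"
  shows "(\<Sum>M\<in>UNIV. wedge_coeff I J M * wedge_coeff M K L)
       = (\<Sum>M\<in>UNIV. wedge_coeff J K M * wedge_coeff I M L)"
proof -
  define inv where "inv A B = {(i, j). i \<in> A \<and> j \<in> B \<and> j < i}" for A B :: "'n set"
  have w: "wedge_coeff A B C = (if A \<inter> B = {} \<and> C = A \<union> B then (- 1) ^ card (inv A B) else 0)"
    for A B C :: "'n set" by (simp add: wedge_coeff_def inv_def)
  have l: "(\<Sum>M\<in>UNIV. wedge_coeff I J M * wedge_coeff M K L)
      = wedge_coeff I J (I \<union> J) * wedge_coeff (I \<union> J) K L"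
    by (subst sum.remove[of _ "I \<union> J"]) (auto simp: w intro!: sum.neutral)
  have r: "(\<Sum>M\<in>UNIV. wedge_coeff J K M * wedge_coeff I M L)
      = wedge_coeff J K (J \<union> K) * wedge_coeff I (J \<union> K) L"
    by (subst sum.remove[of _ "J \<union> K"]) (auto simp: w intro!: sum.neutral)
  show ?thesis
  proof (cases "I \<inter> J = {} \<and> I \<inter> K = {} \<and> J \<inter> K = {} \<and> L = I \<union> J \<union> K")
    case True
    have "card (inv (I \<union> J) K) = card (inv I K) + card (inv J K)"
      using True by (subst card_Un_disjoint[symmetric]) (auto simp: inv_def intro!: arg_cong[of _ _ card])
    moreover have "card (inv I (J \<union> K)) = card (inv I J) + card (inv I K)"
      using True by (subst card_Un_disjoint[symmetric]) (auto simp: inv_def intro!: arg_cong[of _ _ card])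
    ultimately show ?thesis
      using True unfolding l r by (simp add: w Int_Un_distrib Int_Un_distrib2 Un_assoc power_add)
  next
    case False
    then have "wedge_coeff I J (I \<union> J) * wedge_coeff (I \<union> J) K L = 0"
      "wedge_coeff J K (J \<union> K) * wedge_coeff I (J \<union> K) L = 0"
      unfolding w mult_eq_0_iff by (simp_all add: Int_Un_distrib Int_Un_distrib2 Un_assoc)
    then show ?thesis unfolding l r by (simp only:)
  qed
qed

end

theory Submission
  imports Defs
begin

text \<open>
  The Leibniz rule already fails on \<open>0\<close>-forms, for \<open>\<omega> = \<eta> = X\<^sub>i\<close>.  The coefficient of
  \<open>dX\<^sub>i\<close> in \<open>d (X\<^sub>i\<^sup>2)\<close> is the Caputo derivative \<open>\<Gamma>(2\<alpha> + 1) / \<Gamma>(\<alpha> + 1)\<^sup>2 * X\<^sub>i\<close>, whereas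
  \<open>X\<^sub>i\<close> has derivative \<open>1\<close>, so that the Leibniz rule would make this coefficient \<open>2 X\<^sub>i\<close>.  At a
  point where \<open>X\<^sub>i \<noteq> 0\<close> the two agree only if the central binomial ratio
  \<open>\<Gamma>(2\<alpha> + 1) / \<Gamma>(\<alpha> + 1)\<^sup>2\<close> equals \<open>2\<close>.  This is its value at \<open>\<alpha> = 1\<close>, and it is strictly
  increasing in \<open>\<alpha>\<close> because the digamma function is (\<open>Gamma_central_less\<close>); hence it is smaller
  than \<open>2\<close> for \<open>\<alpha> < 1\<close>.
\<close>

text \<open>
  The derivative of \<open>ln \<Gamma>(2t + 1) - 2 ln \<Gamma>(t + 1)\<close> is \<open>2 (\<psi>(2t + 1) - \<psi>(t + 1))\<close>, which is
  positive for \<open>t > 0\<close>; the bound compares the values at \<open>a\<close> and at \<open>1\<close>.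
\<close>

lemma Gamma_central_less:
  fixes a :: real
  assumes "0 < a" "a < 1"
  shows "Gamma (2 * a + 1) < 2 * Gamma (a + 1) ^ 2"
proof -
  have pos: "Gamma (a + 1) > 0" "Gamma (2 * a + 1) > 0"
    using assms by (simp_all add: Gamma_real_pos)
  define h :: "real \<Rightarrow> real" where "h t = ln_Gamma (2 * t + 1) - 2 * ln_Gamma (t + 1)" for t
  have "h a < h 1"
  proof (rule DERIV_pos_imp_increasing[OF assms(2)])
    fix t assume t: "a \<le> t" "t \<le> 1"
    have "(h has_real_derivative 2 * Digamma (2 * t + 1) - 2 * Digamma (t + 1)) (at t)"
      unfolding h_def using t assms by (auto intro!: derivative_eq_intros)
    moreover have "Digamma (t + 1) < Digamma (2 * t + 1)"
      using t assms by (intro Digamma_real_strict_mono) auto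
    ultimately show "\<exists>y. (h has_real_derivative y) (at t) \<and> 0 < y"
      by (intro exI conjI) auto
  qed
  moreover have "h 1 = ln 2"
    using Gamma_fact[of 2, where 'a = real] Gamma_fact[of 1, where 'a = real]
    by (simp add: h_def ln_Gamma_real_pos fact_numeral)
  moreover have "h a = ln (Gamma (2 * a + 1) / Gamma (a + 1) ^ 2)"
    using assms
    by (simp add: h_def ln_Gamma_real_pos ln_div ln_realpow less_imp_neq[OF pos(1), symmetric]
        less_imp_neq[OF pos(2), symmetric])
  ultimately have "Gamma (2 * a + 1) / Gamma (a + 1) ^ 2 < 2"
    using pos by simp
  then show ?thesis using pos by (simp add: divide_less_eq)
qed

definition scalar_form :: "(real ^ 'n \<Rightarrow> real) \<Rightarrow> 'n frac_form" where
  "scalar_form f = (\<lambda>I. if I = {} then f else (\<lambda>x. 0))"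

lemma scalar_form_deg:
  fixes f :: "real ^ 'n::finite \<Rightarrow> real"
  assumes "f \<in> frac_poly \<alpha> U"
  shows "scalar_form f \<in> frac_forms_deg \<alpha> U 0"
  using assms frac_poly.const[of U 0 \<alpha>]
  by (auto simp: frac_forms_deg_def frac_forms_def scalar_form_def)

lemma wedge_coeff_empty_left: "wedge_coeff {} J K = (if K = J then 1 else 0)"
  by (simp add: wedge_coeff_def)

lemma wedge_coeff_empty_right: "wedge_coeff I {} K = (if K = I then 1 else 0)"
  by (simp add: wedge_coeff_def)

lemma wedge_scalar_left:
  fixes \<eta> :: "'n::{finite,linorder} frac_form"
  shows "wedge (scalar_form f) \<eta> = (\<lambda>K x. f x * \<eta> K x)"
proof (intro ext)
  fix K x
  have "wedge (scalar_form f) \<eta> K x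
      = (\<Sum>I\<in>(UNIV :: 'n set set). if I = {} then \<Sum>J\<in>UNIV. wedge_coeff {} J K * (f x * \<eta> J x) else 0)"
    unfolding wedge_def by (rule sum.cong[OF refl]) (simp add: scalar_form_def)
  also have "\<dots> = (\<Sum>J\<in>UNIV. if K = J then f x * \<eta> J x else 0)"
    by (simp add: wedge_coeff_empty_left mult_delta_left)
  finally show "wedge (scalar_form f) \<eta> K x = f x * \<eta> K x" by simp
qed

lemma wedge_scalar_right:
  fixes \<omega> :: "'n::{finite,linorder} frac_form"
  shows "wedge \<omega> (scalar_form g) = (\<lambda>K x. \<omega> K x * g x)"
proof (intro ext)
  fix K x
  have "wedge \<omega> (scalar_form g) K x
      = (\<Sum>I\<in>UNIV. \<Sum>J\<in>(UNIV :: 'n set set). if J = {} then wedge_coeff I {} K * (\<omega> I x * g x) else 0)"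
    unfolding wedge_def by (intro sum.cong refl) (simp add: scalar_form_def)
  also have "\<dots> = (\<Sum>I\<in>UNIV. if K = I then \<omega> I x * g x else 0)"
    by (simp add: wedge_coeff_empty_right mult_delta_left)
  finally show "wedge \<omega> (scalar_form g) K x = \<omega> K x * g x" by simp
qed

lemma caputo_zero:
  fixes b :: "real ^ 'n"
  assumes "0 < \<alpha>" "\<And>i. 0 < b $ i"
  shows "caputo \<alpha> (cbox 0 b) i (\<lambda>x. 0) x = 0"
proof -
  have "is_frac_expansion \<alpha> (cbox 0 b) (\<lambda>x. 0) (\<lambda>m. 0)"
    by (rule is_frac_expansionI[of "{}"]) auto
  from caputo_expansion[OF assms this, of "{}"] show ?thesis by simp
qed

lemma frac_d_scalar_form:
  fixes b :: "real ^ 'n::{finite,linorder}"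
  assumes "0 < \<alpha>" "\<And>i. 0 < b $ i"
  shows "frac_d \<alpha> (cbox 0 b) (scalar_form f) {i} x = caputo \<alpha> (cbox 0 b) i f x"
proof -
  have "frac_d \<alpha> (cbox 0 b) (scalar_form f) {i} x
      = (\<Sum>I\<in>(UNIV :: 'n set set). if I = {} then
           \<Sum>j\<in>UNIV. wedge_coeff {j} {} {i} * caputo \<alpha> (cbox 0 b) j f x else 0)"
    unfolding frac_d_def
    by (rule sum.cong[OF refl]) (simp add: scalar_form_def caputo_zero[OF assms])
  also have "\<dots> = (\<Sum>j\<in>UNIV. if i = j then caputo \<alpha> (cbox 0 b) j f x else 0)"
    by (simp add: wedge_coeff_empty_right mult_delta_left)
  finally show ?thesis by simp
qed

text \<open>
  The guard \<open>x \<in> U\<close> is needed for \<open>n = 0\<close>, where the left-hand side is the unit of the algebra,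
  the function \<open>1\<close> on \<open>U\<close> extended by \<open>0\<close>, while \<open>0 ^ 0 = 1\<close> outside \<open>U\<close>.
\<close>

lemma frac_X_power_eq_monom:
  fixes i :: "'n::finite"
  shows "frac_monom \<alpha> U ((\<lambda>_. 0)(i := n)) x = (if x \<in> U then frac_X \<alpha> U i x ^ n else 0)"
proof -
  have "(\<Prod>k\<in>UNIV. frac_X \<alpha> U k x ^ ((\<lambda>_. 0)(i := n)) k)
      = (\<Prod>k\<in>UNIV. if k = i then frac_X \<alpha> U k x ^ n else 1)"
    by (intro prod.cong) auto
  then show ?thesis by (simp add: frac_monom_def)
qed

lemma caputo_frac_X_power:
  fixes b :: "real ^ 'n::finite"
  assumes "0 < \<alpha>" "\<And>i. 0 < b $ i" "x \<in> cbox 0 b"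
  shows "caputo \<alpha> (cbox 0 b) i (\<lambda>x. if x \<in> cbox 0 b then frac_X \<alpha> (cbox 0 b) i x ^ Suc n else 0) x
       = Gamma (real (Suc n) * \<alpha> + 1) / (Gamma (real n * \<alpha> + 1) * Gamma (1 + \<alpha>))
         * frac_X \<alpha> (cbox 0 b) i x ^ n"
proof -
  have "caputo_monom \<alpha> (cbox 0 b) i ((\<lambda>_. 0)(i := Suc n)) x
      = Gamma (real (Suc n) * \<alpha> + 1) / (Gamma (real n * \<alpha> + 1) * Gamma (1 + \<alpha>))
        * frac_X \<alpha> (cbox 0 b) i x ^ n"
    using assms(3) by (simp add: caputo_monom_def frac_X_power_eq_monom del: of_nat_Suc)
  then show ?thesis
    using caputo_frac_monom[OF assms(1,2), of i "(\<lambda>_. 0)(i := Suc n)"]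
    by (simp only: frac_X_power_eq_monom[abs_def])
qed

theorem proposition5p9:
  fixes \<alpha> :: real and b :: "real ^ 'n::{finite,linorder}" and U :: "(real ^ 'n::{finite,linorder}) set"
  assumes "0 < \<alpha>" and "\<alpha> < 1"
    and "\<And>i. 0 < b $ i"
    and "U = cbox 0 b"
  shows "\<not> graded_derivation \<alpha> U (frac_d \<alpha> U) \<and>
    (\<exists>p q. \<exists>\<omega>\<in>frac_forms_deg \<alpha> U p. \<exists>\<eta>\<in>frac_forms_deg \<alpha> U q.
       frac_d \<alpha> U (wedge \<omega> \<eta>)
         \<noteq> (\<lambda>I x. wedge (frac_d \<alpha> U \<omega>) \<eta> I x + (- 1) ^ p * wedge \<omega> (frac_d \<alpha> U \<eta>) I x))"
proof -
  define i :: 'n where "i = undefined"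
  define X where "X = frac_X \<alpha> U i"
  define \<omega> where "\<omega> = scalar_form X"
  have G: "Gamma (1 + \<alpha>) > 0" using assms(1) by (simp add: Gamma_real_pos)
  \<comment> \<open>The corner \<open>b\<close> is the test point: it lies in \<open>U\<close> and none of its coordinates vanish.\<close>
  have "b \<in> U" using assms(3,4) by (auto simp: mem_box_cart intro: less_imp_le)
  moreover have "b $ i \<noteq> 0" using assms(3)[of i] by simp
  ultimately have X_b: "X b \<noteq> 0" using G by (auto simp: X_def frac_X_def)
  \<comment> \<open>The functions \<open>X\<close> and \<open>X\<^sup>2\<close>, put in the form of the power rule for \<open>caputo\<close>.\<close>
  have X1: "X = (\<lambda>x. if x \<in> U then X x ^ Suc 0 else 0)"
    and X2: "(\<lambda>x. X x * X x) = (\<lambda>x. if x \<in> U then X x ^ Suc 1 else 0)"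
    by (auto simp: X_def frac_X_def)
  note D = caputo_frac_X_power[OF assms(1,3), of b i, folded assms(4), folded X_def, OF \<open>b \<in> U\<close>]
  have DX: "caputo \<alpha> U i X b = 1"
    using D[of 0] G by (subst X1) (simp add: add.commute)
  have DX2: "caputo \<alpha> U i (\<lambda>x. X x * X x) b = Gamma (2 * \<alpha> + 1) / Gamma (1 + \<alpha>) ^ 2 * X b"
    unfolding X2 using D[of 1] by (simp add: add.commute power2_eq_square)
  note d = frac_d_scalar_form[OF assms(1,3), folded assms(4)]
  have \<omega>: "\<omega> \<in> frac_forms_deg \<alpha> U 0"
    unfolding \<omega>_def X_def by (intro scalar_form_deg frac_poly.gen)
  have sq: "wedge \<omega> \<omega> = scalar_form (\<lambda>x. X x * X x)"
    unfolding \<omega>_def wedge_scalar_left by (auto simp: scalar_form_def)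
  have "frac_d \<alpha> U (wedge \<omega> \<omega>) {i} b = Gamma (2 * \<alpha> + 1) / Gamma (1 + \<alpha>) ^ 2 * X b"
    by (simp add: sq d DX2)
  moreover have "wedge (frac_d \<alpha> U \<omega>) \<omega> {i} b + (- 1) ^ 0 * wedge \<omega> (frac_d \<alpha> U \<omega>) {i} b = 2 * X b"
    by (simp add: \<omega>_def wedge_scalar_left wedge_scalar_right d DX)
  moreover have "Gamma (2 * \<alpha> + 1) / Gamma (1 + \<alpha>) ^ 2 \<noteq> 2"
    using Gamma_central_less[OF assms(1,2)] G by (simp add: field_simps)
  then have "Gamma (2 * \<alpha> + 1) / Gamma (1 + \<alpha>) ^ 2 * X b \<noteq> 2 * X b"
    by (simp only: mult_right_cancel[OF X_b] not_False_eq_True)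
  ultimately have "frac_d \<alpha> U (wedge \<omega> \<omega>) {i} b
      \<noteq> wedge (frac_d \<alpha> U \<omega>) \<omega> {i} b + (- 1) ^ 0 * wedge \<omega> (frac_d \<alpha> U \<omega>) {i} b"
    by (simp only: not_False_eq_True)
  then have "frac_d \<alpha> U (wedge \<omega> \<omega>)
      \<noteq> (\<lambda>I x. wedge (frac_d \<alpha> U \<omega>) \<omega> I x + (- 1) ^ 0 * wedge \<omega> (frac_d \<alpha> U \<omega>) I x)"
    by metis
  with \<omega> have fails: "\<exists>p q. \<exists>\<omega>\<in>frac_forms_deg \<alpha> U p. \<exists>\<eta>\<in>frac_forms_deg \<alpha> U q.
       frac_d \<alpha> U (wedge \<omega> \<eta>)
         \<noteq> (\<lambda>I x. wedge (frac_d \<alpha> U \<omega>) \<eta> I x + (- 1) ^ p * wedge \<omega> (frac_d \<alpha> U \<eta>) I x)"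
    by blast
  then show ?thesis
    unfolding graded_derivation_def graded_leibniz_def by blast
qed

end
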